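(* Let $G$ be a weakly connected oriented graph on $n\ge 2$ vertices with $m\ge 1$ edges, with non-zero edge weights in $\mathbb{C}\setminus\mathbb{R}^-$, and let $N$ be its complex signless incidence matrix. Then $\operatorname{rank}(N)=n-1$ if and only if either $G$ is a tree, or $wt(C)\in\mathbb{R}^+$ for all even cycles $C$ of $G$ and $wt(C)\in\mathbb{R}^-$ for all odd cycles $C$ of $G$.
   Context: An oriented graph $G$ is obtained from a finite simple undirected graph $G_u$ (its underlying graph) by giving each edge exactly one direction; it is weakly connected if $G_u$ is connected, and it is called a tree if $G_u$ is a tree. Write $V(G)=\{1,\dots,n\}$ and $E(G)=\{e_1,\dots,e_m\}$. Each directed edge $(u,v)$ (from $u$ to $v$) has a non-zero complex weight $w_{uv}$. $\mathbb{R}^+$ and $\mathbb{R}^-$ denote the positive and the negative real numbers, and $\sqrt{\cdot}$ is the principal square root. The complex signless incidence matrix of $G$ is the $n\times m$ matrix $N=(n_{ij})$ where, for $e_j=(u,v)$, $n_{ij}=\sqrt{w_{uv}}$ if $i=u$, $n_{ij}=\sqrt{\overline{w_{uv}}}$ if $i=v$, and $n_{ij}=0$ otherwise. Put $a_{ij}=w_{ij}$ if $(i,j)\in E(G)$, $a_{ij}=\overline{w_{ji}}$ if $(j,i)\in E(G)$, and $a_{ij}=0$ otherwise. The weight of a walk $\gamma=(i_1,\dots,i_k)$ in $G_u$ is $wt(\gamma)=\prod_{s=1}^{k-1}a_{i_si_{s+1}}$. A cycle of $G$ means a cycle of $G_u$ (even or odd according to its length); $wt(C)$ is the weight of the closed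 walk going once around $C$ in either direction. The two directions give complex conjugate values, so the conditions $wt(C)\in\mathbb{R}^{\pm}$ do not depend on the choice. *)

theory Defs
  imports
    Complex_Main
    "Graph_Theory.Digraph_Component"
    "Graph_Theory.Vertex_Walk"
    "Jordan_Normal_Form.DL_Rank"
begin

(* pair_digraph: finite, no loops, arcs are pairs of vertices (hence no parallel arcs). *)
definition oriented_graph :: "'a pair_pre_digraph \<Rightarrow> bool" where
  "oriented_graph G \<longleftrightarrow>
     pair_digraph G \<and> (\<forall>u v. (u, v) \<in> parcs G \<longrightarrow> (v, u) \<notin> parcs G)"

(* The underlying undirected graph, represented by its symmetric arc set. *)
definition underlying :: "'a pair_pre_digraph \<Rightarrow> ('a, 'a \<times> 'a) pre_digraph" where
  "underlying G = with_proj (mk_symmetric (with_proj G))"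

(* Connectedness in Graph_Theory is already that of the symmetric closure. *)
definition weakly_connected :: "'a pair_pre_digraph \<Rightarrow> bool" where
  "weakly_connected G \<longleftrightarrow> Digraph_Component.connected (with_proj G)"

(* A cycle of the underlying graph, as a closed vertex walk whose end vertex repeats the
   start vertex: a cycle with k edges is a list of length k + 1.  At least three edges are
   required, which excludes walking back and forth along one edge.  Each cycle is represented
   by one list for every choice of base point and direction. *)
definition ug_cycle :: "'a pair_pre_digraph \<Rightarrow> 'a vwalk \<Rightarrow> bool" where
  "ug_cycle G p \<longleftrightarrow>
     vwalk p (underlying G) \<and> hd p = last p \<and> distinct (tl p) \<and> vwalk_length p \<ge> 3"

(* Graph_Theory's own tree predicate only forbids directed cycles, so it does not say that
   the underlying graph is a tree. *)
definition ug_tree :: "'a pair_pre_digraph \<Rightarrow> bool" where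
  "ug_tree G \<longleftrightarrow> weakly_connected G \<and> \<not> (\<exists>p. ug_cycle G p)"

definition positive_reals :: "complex set" where
  "positive_reals = complex_of_real ` {0<..}"

definition negative_reals :: "complex set" where
  "negative_reals = complex_of_real ` {..<0}"

definition adj_entry ::
  "'a pair_pre_digraph \<Rightarrow> ('a \<Rightarrow> 'a \<Rightarrow> complex) \<Rightarrow> 'a \<Rightarrow> 'a \<Rightarrow> complex" where
  "adj_entry G w i j =
     (if (i, j) \<in> parcs G then w i j
      else if (j, i) \<in> parcs G then cnj (w j i)
      else 0)"

definition walk_weight ::
  "'a pair_pre_digraph \<Rightarrow> ('a \<Rightarrow> 'a \<Rightarrow> complex) \<Rightarrow> 'a vwalk \<Rightarrow> complex" where
  "walk_weight G w p = prod_list (map (\<lambda>(i, j). adj_entry G w i j) (vwalk_arcs p))"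

definition incidence_entry :: "('a \<Rightarrow> 'a \<Rightarrow> complex) \<Rightarrow> 'a \<Rightarrow> 'a \<times> 'a \<Rightarrow> complex" where
  "incidence_entry w i uv =
     (case uv of (u, v) \<Rightarrow>
        if i = u then csqrt (w u v)
        else if i = v then csqrt (cnj (w u v))
        else 0)"

(* Vertices 1..n, edges e 1, ..., e m.  Matrix indices start at 0, so row i belongs to
   vertex i + 1 and column j to edge e (j + 1). *)
definition signless_incidence ::
  "nat \<Rightarrow> nat \<Rightarrow> (nat \<Rightarrow> nat \<times> nat) \<Rightarrow> (nat \<Rightarrow> nat \<Rightarrow> complex) \<Rightarrow> complex mat" where
  "signless_incidence n m e w = mat n m (\<lambda>(i, j). incidence_entry w (i + 1) (e (j + 1)))"

end

theory Submission
  imports Defs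
begin

text \<open>
  A row vector \<open>x\<close> annihilates the column of an edge \<open>(u, v)\<close> iff
  \<open>x\<^sub>v = - sgn a\<^sub>u\<^sub>v * x\<^sub>u\<close>, because \<open>csqrt w / cnj (csqrt w) = sgn w\<close>.  Call the product of the factors
  \<open>- sgn a\<^sub>i\<^sub>j\<close> along a walk its gain.  Modulo the column space, the unit vector of the end of a walk
  is the gain times the unit vector of its start, so by connectedness the column space together with one
  unit vector is everything, and the rank is at least \<open>n - 1\<close>.  A closed walk of gain \<open>\<noteq> 1\<close> puts
  a unit vector into the column space and makes the rank \<open>n\<close>; if all closed walks have gain \<open>1\<close>, the
  gains of walks from a fixed vertex form a nonzero annihilator.  Splitting a closed walk at
  a repeated vertex shows that only cycles need to be tested, and the gain of a cycle of length \<open>k\<close> is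
  \<open>(- 1)\<^sup>k\<close> times the sign of its weight.  Trees satisfy the cycle condition vacuously.
\<close>

section \<open>Gains of walks\<close>

text \<open>The values lie in a commutative monoid so that the factors of a closed subwalk can be
  collected and split off.\<close>

definition gain :: "('a \<Rightarrow> 'a \<Rightarrow> 'b::comm_monoid_mult) \<Rightarrow> 'a vwalk \<Rightarrow> 'b" where
  "gain f p = prod_list (map (\<lambda>(i, j). f i j) (vwalk_arcs p))"

lemma gain_simps [simp]:
  "gain f [] = 1" "gain f [u] = 1" "gain f (u # v # p) = f u v * gain f (v # p)"
  by (simp_all add: gain_def)

text \<open>The cut vertex \<open>v\<close> stays in both pieces, so that every arc falls into
  exactly one of them.\<close>

lemma gain_join: "gain f (p @ v # q) = gain f (p @ [v]) * gain f (v # q)"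
  by (induction p rule: vwalk_arcs.induct) (simp_all add: mult.assoc)

lemma vwalk_join: "vwalk (p @ v # q) H \<longleftrightarrow> vwalk (p @ [v]) H \<and> vwalk (v # q) H"
  by (induction p rule: vwalk_arcs.induct) (auto simp: vwalk_def)

text \<open>Strong induction on the length: a vertex repeated in the tail cuts out a shorter closed
  walk and leaves another one. Without repetition the walk is a cycle or has at most two
  arcs.\<close>

lemma closed_walk_gain_one:
  fixes f :: "'a \<Rightarrow> 'a \<Rightarrow> 'b::comm_monoid_mult"
  assumes noloop: "\<And>u. (u, u) \<notin> arcs_ends H"
    and inv: "\<And>u v. (u, v) \<in> arcs_ends H \<Longrightarrow> f u v * f v u = 1"
    and cycle: "\<And>p. vwalk p H \<Longrightarrow> hd p = last p \<Longrightarrow> distinct (tl p) \<Longrightarrow> vwalk_length p \<ge> 3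
      \<Longrightarrow> gain f p = 1"
    and "vwalk p H" "hd p = last p"
  shows "gain f p = 1"
  using assms(4,5)
proof (induction p rule: length_induct)
  case (1 p)
  then have IH: "gain f q = 1" if "length q < length p" "vwalk q H" "hd q = last q" for q
    using that by blast
  have "p \<noteq> []" using 1 by (auto simp: vwalk_def)
  then obtain u r where p: "p = u # r" by (cases p) auto
  show ?case
  proof (cases "distinct r")
    case True
    show ?thesis
    proof (cases "vwalk_length p \<ge> 3")
      case True
      then show ?thesis using 1 \<open>distinct r\<close> cycle p by simp
    next
      case False
      \<comment> \<open>A closed walk with fewer than three arcs is trivial, a loop, or one edge run
        back and forth, where \<open>inv\<close> applies.\<close>
      then consider "r = []" | v where "r = [v]" | v x where "r = [v, x]"
        unfolding p by (cases r rule: vwalk_arcs.cases) (auto simp: Suc_le_eq)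
      then show ?thesis
      proof cases
        case 1
        then show ?thesis by (simp add: p)
      next
        case (2 v)
        then show ?thesis using "1.prems" noloop by (auto simp: p vwalk_def)
      next
        case (3 v x)
        then show ?thesis using "1.prems" inv by (auto simp: p vwalk_def)
      qed
    qed
  next
    case False
    then obtain a v b c where r: "r = a @ [v] @ b @ [v] @ c"
      using not_distinct_decomp by blast
    \<comment> \<open>Both are shorter than \<open>p\<close>: \<open>?in\<close> omits the leading
      \<open>u\<close>, and \<open>?out\<close> omits \<open>b\<close> and one
      \<open>v\<close>.\<close>
    let ?in = "v # b @ [v]" and ?out = "(u # a) @ v # c"
    have "vwalk ((u # a) @ v # (b @ v # c)) H"
      using 1 by (simp add: p r)
    then have w: "vwalk ((u # a) @ [v]) H" "vwalk ?in H" "vwalk (v # c) H"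
      using vwalk_join[of "u # a" v "b @ v # c"] vwalk_join[of "v # b" v c] by auto
    have "gain f p = gain f ((u # a) @ [v]) * (gain f ?in * gain f (v # c))"
      using gain_join[of f "u # a" v "b @ v # c"] gain_join[of f "v # b" v c]
      by (simp add: p r)
    also have "\<dots> = gain f ?in * gain f ?out"
      using gain_join[of f "u # a" v c] by (simp add: ac_simps)
    finally have split: "gain f p = gain f ?in * gain f ?out" .
    have inner: "gain f ?in = 1"
      by (rule IH) (use w in \<open>auto simp: p r\<close>)
    have outer: "gain f ?out = 1"
    proof (rule IH)
      show "vwalk ?out H" using w vwalk_join[of "u # a" v c H] by simp
      show "hd ?out = last ?out" using 1(3) by (auto simp: p r)
    qed (simp add: p r)
    show ?thesis unfolding split inner outer by simp
  qed
qed

text \<open>The potential at a vertex is the gain of any walk to it from \<open>r\<close>. Two such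
  walks agree because a common return walk \<open>s\<close> closes both, so \<open>gain f s\<close>
  is inverse to both gains.\<close>

lemma potential_exists:
  fixes f :: "'a \<Rightarrow> 'a \<Rightarrow> 'b::comm_monoid_mult"
  assumes conn: "\<And>u v. u \<in> verts H \<Longrightarrow> v \<in> verts H \<Longrightarrow> \<exists>p. vwalk p H \<and> hd p = u \<and> last p = v"
    and closed: "\<And>p. vwalk p H \<Longrightarrow> hd p = last p \<Longrightarrow> gain f p = 1"
    and "r \<in> verts H"
  obtains x where "x r = 1"
    and "\<And>u v. u \<in> verts H \<Longrightarrow> v \<in> verts H \<Longrightarrow> (u, v) \<in> arcs_ends H \<Longrightarrow> x v = x u * f u v"
proof -
  define P where "P v = (SOME p. vwalk p H \<and> hd p = r \<and> last p = v)" for v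
  have P: "vwalk (P v) H \<and> hd (P v) = r \<and> last (P v) = v" if "v \<in> verts H" for v
    unfolding P_def using someI_ex[OF conn[OF assms(3) that]] .
  have unique: "gain f p = gain f q"
    if p: "vwalk p H" "hd p = r" and q: "vwalk q H" "hd q = r" "last p = last q" for p q
  proof -
    have "last p \<in> verts H" using p by (auto simp: vwalk_def)
    then obtain s where s: "vwalk s H" "hd s = last p" "last s = r"
      using conn[OF _ assms(3)] by blast
    have inv: "gain f t * gain f s = 1" if t: "vwalk t H" "hd t = r" "last t = last p" for t
    proof -
      have ne: "t \<noteq> []" "s \<noteq> []" using s t by (auto simp: vwalk_def)
      have T: "t = butlast t @ [last p]" "s = last p # tl s"
        using ne t(3) s(2) by (metis append_butlast_last_id, metis list.collapse)
      let ?c = "butlast t @ last p # tl s"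
      have "vwalk ?c H" using vwalk_join T s(1) t(1) by metis
      moreover have "hd ?c = last ?c"
        using T s(3) t(2) by (metis hd_append2 last_appendR list.distinct(1) list.sel(1) self_append_conv2)
      ultimately have "gain f ?c = 1" by (rule closed)
      then show ?thesis using gain_join T by metis
    qed
    have "gain f p = gain f p * (gain f q * gain f s)" using inv q by simp
    also have "\<dots> = gain f q * (gain f p * gain f s)" by (simp add: ac_simps)
    also have "\<dots> = gain f q" using inv p by simp
    finally show ?thesis .
  qed
  show thesis
  proof
    \<comment> \<open>The walk chosen from \<open>r\<close> to itself may be nontrivial, but it is
      closed.\<close>
    show "gain f (P r) = 1" using P[OF assms(3)] closed by metis
    fix u v assume uv: "u \<in> verts H" "v \<in> verts H" "(u, v) \<in> arcs_ends H"
    have Pu: "P u = butlast (P u) @ [u]"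
      using P[OF uv(1)] by (metis append_butlast_last_id vwalk_def)
    let ?q = "butlast (P u) @ u # [v]"
    have "vwalk (butlast (P u) @ [u]) H" using Pu P[OF uv(1)] by simp
    moreover have "vwalk [u, v] H" using uv by (simp add: vwalk_def)
    ultimately have "vwalk ?q H" using vwalk_join by metis
    moreover have "hd ?q = r" using Pu P[OF uv(1)] by (metis hd_append2 list.sel(1) self_append_conv2)
    ultimately have "gain f (P v) = gain f ?q"
      using P[OF uv(2)] by (intro unique) auto
    also have "\<dots> = gain f (P u) * f u v" using gain_join Pu by (metis gain_simps(2,3) mult.right_neutral)
    finally show "gain f (P v) = gain f (P u) * f u v" .
  qed
qed

section \<open>Rank and column span\<close>

context vec_space begin

text \<open>Take a maximal independent set of columns: any column outside its span could be added.
  This turns statements on the rank into statements on the span.\<close>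

lemma rank_basis:
  assumes "A \<in> carrier_mat n nc"
  obtains B where "B \<subseteq> carrier_vec n" "finite B" "lin_indpt B" "card B = rank A"
    "span B = span (set (cols A))"
proof -
  let ?C = "set (cols A)"
  have C: "?C \<subseteq> carrier_vec n" using cols_dim assms by blast
  obtain B where B: "maximal B (\<lambda>T. T \<subseteq> ?C \<and> lin_indpt T)"
    using maximal_exists[of "\<lambda>T. T \<subseteq> ?C \<and> lin_indpt T" "card ?C" "{}"]
    by (meson List.finite_set card_mono empty_iff empty_subsetI finite_lin_indpt2 rev_finite_subset)
  then have BC: "B \<subseteq> ?C" "lin_indpt B" by (auto simp: maximal_def)
  have "c \<in> span B" if "c \<in> ?C" for c
  proof (rule ccontr)
    assume "c \<notin> span B"
    then have "lin_indpt (B \<union> {c})" "c \<notin> B"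
      using BC C that lin_dep_iff_in_span[of B c] in_own_span[of B] by auto
    then show False using B that BC unfolding maximal_def
      by (metis Un_insert_right insert_subset subset_insertI sup_bot.right_neutral insertI1)
  qed
  then have "span B = span ?C"
    using span_subsetI[of B ?C] span_is_monotone[OF BC(1)] BC C by blast
  then show thesis
    using that[of B] BC C rank_card_indpt[OF assms B] finite_subset[OF BC(1)] by auto
qed

lemma rank_eq_dim_iff:
  assumes "A \<in> carrier_mat n nc"
  shows "rank A = n \<longleftrightarrow> span (set (cols A)) = carrier_vec n"
proof -
  obtain B where B: "B \<subseteq> carrier_vec n" "finite B" "lin_indpt B" "card B = rank A"
    "span B = span (set (cols A))"
    using rank_basis[OF assms] .
  show ?thesis
  proof
    assume "rank A = n"
    then have "basis B" using B dim_is_n by (intro dim_li_is_basis) auto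
    then show "span (set (cols A)) = carrier_vec n" using B by (auto simp: basis_def)
  next
    assume "span (set (cols A)) = carrier_vec n"
    then have "basis B" using B by (auto simp: basis_def)
    then show "rank A = n" using dim_basis[of B] dim_is_n B by simp
  qed
qed

lemma rank_le_dim:
  assumes "A \<in> carrier_mat n nc"
  shows "rank A \<le> n"
proof -
  obtain B where "B \<subseteq> carrier_vec n" "lin_indpt B" "card B = rank A"
    using rank_basis[OF assms] .
  then show ?thesis using li_le_dim(2)[OF fin_dim, of B] dim_is_n by simp
qed

text \<open>A basis of the column space together with \<open>v\<close> still generates, and it has
  at most \<open>rank A + 1\<close> elements.\<close>

lemma dim_le_Suc_rank:
  assumes A: "A \<in> carrier_mat n nc" and v: "v \<in> carrier_vec n"
    and gen: "carrier_vec n \<subseteq> span (insert v (set (cols A)))"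
  shows "n \<le> Suc (rank A)"
proof -
  obtain B where B: "B \<subseteq> carrier_vec n" "finite B" "lin_indpt B" "card B = rank A"
    "span B = span (set (cols A))"
    using rank_basis[OF A] .
  have C: "set (cols A) \<subseteq> carrier_vec n" using cols_dim A by blast
  have vB: "insert v B \<subseteq> carrier_vec n" using B v by auto
  have "set (cols A) \<subseteq> span (insert v B)"
    using in_own_span[OF C] B(5) span_is_monotone[of B "insert v B"] by blast
  moreover have "v \<in> span (insert v B)" using in_own_span[OF vB] by blast
  ultimately have "span (insert v (set (cols A))) \<subseteq> span (insert v B)"
    by (intro span_subsetI[OF vB]) auto
  then have "span (insert v B) = carrier_vec n" using gen span_closed[OF vB] by auto
  then have "dim \<le> card (insert v B)" using vB B(2) by (intro gen_ge_dim) auto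
  then show ?thesis using B(2,4) dim_is_n by (simp add: card_insert_if split: if_splits)
qed

text \<open>What annihilates \<open>U\<close> annihilates \<open>span U\<close>; if that were
  everything, pairing with unit vectors would make \<open>x\<close> zero. The scalar product is
  bilinear, without conjugation.\<close>

lemma span_neq_carrier:
  assumes U: "U \<subseteq> carrier_vec n" and x: "x \<in> carrier_vec n" "x \<noteq> 0\<^sub>v n"
    and ann: "\<And>y. y \<in> U \<Longrightarrow> x \<bullet> y = 0"
  shows "span U \<noteq> carrier_vec n"
proof
  assume full: "span U = carrier_vec n"
  have "x \<in> orthogonal_complement (span U)"
    using in_orthogonal_complement_span[OF U] x ann by (simp add: orthogonal_complement_def)
  then have "x \<bullet> unit_vec n i = 0" for i
    unfolding full orthogonal_complement_def by simp
  then have "x $ i = 0" if "i < n" for i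
    using scalar_prod_right_unit[OF that] by metis
  then have "x = 0\<^sub>v n"
    using x(1) by (intro eq_vecI) auto
  then show False using x by simp
qed

text \<open>Modulo \<open>span U\<close>, each arc identifies \<open>b v\<close> with
  \<open>f u v\<close> times \<open>b u\<close>; along a walk the factors multiply.\<close>

lemma walk_combination_in_span:
  assumes U: "U \<subseteq> carrier_vec n" and b: "\<And>u. b u \<in> carrier_vec n"
    and step: "\<And>u v. (u, v) \<in> arcs_ends H \<Longrightarrow> b v + (- f u v) \<cdot>\<^sub>v b u \<in> span U"
    and p: "vwalk p H"
  shows "b (last p) + (- gain f p) \<cdot>\<^sub>v b (hd p) \<in> span U"
  using p
proof induction
  case (Base u)
  have "b u + (- 1) \<cdot>\<^sub>v b u = 0\<^sub>v n" using b[of u] by (intro eq_vecI) auto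
  then show ?case using vectorspace.span_zero[OF vectorspace_axioms, of U] by simp
next
  case (Cons u v es)
  let ?g = "gain f (v # es)" and ?l = "b (last (v # es))"
  \<comment> \<open>The relation of the first arc is scaled by the gain of the rest, so that
    \<open>b v\<close> cancels.\<close>
  have "(?l + (- ?g) \<cdot>\<^sub>v b v) + ?g \<cdot>\<^sub>v (b v + (- f u v) \<cdot>\<^sub>v b u) \<in> span U"
    using span_add1[OF _ Cons(2) smult_in_span[OF U step[OF Cons(1)], of ?g]] U by simp
  moreover have "(?l + (- ?g) \<cdot>\<^sub>v b v) + ?g \<cdot>\<^sub>v (b v + (- f u v) \<cdot>\<^sub>v b u)
    = ?l + (- (f u v * ?g)) \<cdot>\<^sub>v b u"
    using b[of u] b[of v] b[of "last (v # es)"] by (intro eq_vecI) (auto simp: algebra_simps)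
  ultimately show ?case by simp
qed

end

section \<open>Signs and square roots of complex weights\<close>

text \<open>On the branch cut this fails: \<open>csqrt (-1)\<close> is \<open>\<i>\<close>, whose
  conjugate is not a principal root. Off the cut, conjugation preserves principal roots.\<close>

lemma csqrt_cnj:
  assumes "z \<notin> negative_reals"
  shows "csqrt (cnj z) = cnj (csqrt z)"
proof (rule csqrt_unique)
  show "(cnj (csqrt z))\<^sup>2 = cnj z" by (metis complex_cnj_power power2_csqrt)
  show "0 < Re (cnj (csqrt z)) \<or> Re (cnj (csqrt z)) = 0 \<and> 0 \<le> Im (cnj (csqrt z))"
  proof (cases "Re (csqrt z) = 0")
    case True
    \<comment> \<open>A root with real part 0 has a nonpositive real square, so the assumption
      leaves only \<open>z = 0\<close>.\<close>
    then have "csqrt z = \<i> * of_real (Im (csqrt z))" by (simp add: complex_eq_iff del: csqrt.simps)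
    then have "(csqrt z)\<^sup>2 = (\<i> * of_real (Im (csqrt z)))\<^sup>2" by (rule arg_cong)
    then have "z = of_real (- (Im (csqrt z))\<^sup>2)"
      by (simp add: power_mult_distrib del: csqrt.simps)
    then have "\<not> - (Im (csqrt z))\<^sup>2 < 0"
      using assms unfolding negative_reals_def by blast
    then have "Im (csqrt z) = 0" by simp
    then show ?thesis using True by (simp del: csqrt.simps)
  next
    case False
    then show ?thesis using csqrt_principal[of z] by (simp del: csqrt.simps)
  qed
qed

lemma sgn_eq_1_iff: "sgn z = 1 \<longleftrightarrow> z \<in> positive_reals" for z :: complex
proof
  assume "sgn z = 1"
  then show "z \<in> positive_reals"
    unfolding positive_reals_def
    by (intro image_eqI[of _ _ "norm z"]) (auto simp: sgn_eq)
qed (auto simp: positive_reals_def sgn_of_real)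

lemma sgn_eq_minus_1_iff: "sgn z = - 1 \<longleftrightarrow> z \<in> negative_reals" for z :: complex
proof
  assume sgn: "sgn z = - 1"
  then have "z \<noteq> 0" by auto
  then have "z = of_real (- norm z)"
    using sgn by (simp add: sgn_eq divide_eq_eq)
  then show "z \<in> negative_reals"
    unfolding negative_reals_def using \<open>z \<noteq> 0\<close> by (intro image_eqI[of _ _ "- norm z"]) auto
qed (auto simp: negative_reals_def sgn_of_real)

lemma gain_neg_sgn:
  "gain (\<lambda>i j. - sgn (adj_entry G w i j)) p = (- 1) ^ vwalk_length p * sgn (walk_weight G w p)"
  unfolding gain_def walk_weight_def vwalk_length_def
  by (induction p rule: vwalk_arcs.induct) (simp_all add: sgn_mult)

lemma gain_neg_sgn_eq_1_iff:
  "gain (\<lambda>i j. - sgn (adj_entry G w i j)) p = 1 \<longleftrightarrow>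
    (if even (vwalk_length p) then walk_weight G w p \<in> positive_reals
     else walk_weight G w p \<in> negative_reals)"
proof -
  have "- sgn z = 1 \<longleftrightarrow> sgn z = - 1" for z :: complex
    by (metis minus_minus)
  then show ?thesis
    by (simp add: gain_neg_sgn sgn_eq_1_iff sgn_eq_minus_1_iff del: vwalk_length_simp)
qed

lemma arcs_ends_underlying: "arcs_ends (underlying G) = parcs G \<union> (parcs G)\<inverse>"
  by (auto simp: underlying_def parcs_mk_symmetric arcs_ends_conv)

text \<open>Expanding by \<open>csqrt z\<close> turns the quotient into \<open>z / norm z\<close>;
  at \<open>0\<close> both sides are \<open>0\<close>.\<close>

lemma csqrt_quotient: "csqrt z / cnj (csqrt z) = sgn z"
proof -
  have "csqrt z / cnj (csqrt z) = (csqrt z)\<^sup>2 / (csqrt z * cnj (csqrt z))"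
    by (simp add: power2_eq_square del: csqrt.simps)
  also have "\<dots> = z / of_real (norm z)"
    by (simp only: complex_norm_square[symmetric] norm_power[symmetric] power2_csqrt flip: of_real_power)
  finally show ?thesis by (simp add: sgn_eq)
qed


theorem theorem2p6:
  fixes n m :: nat
    and G :: "nat pair_pre_digraph"
    and e :: "nat \<Rightarrow> nat \<times> nat"
    and w :: "nat \<Rightarrow> nat \<Rightarrow> complex"
  assumes "n \<ge> 2" and "m \<ge> 1"
    and "oriented_graph G"
    and "weakly_connected G"
    and "pverts G = {1..n}"
    and "bij_betw e {1..m} (parcs G)"
    and "\<And>u v. (u, v) \<in> parcs G \<Longrightarrow> w u v \<noteq> 0 \<and> w u v \<notin> negative_reals"
  shows "vec_space.rank n (signless_incidence n m e w) = n - 1 \<longleftrightarrow>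
    ug_tree G \<or>
    (\<forall>p. ug_cycle G p \<and> even (vwalk_length p) \<longrightarrow> walk_weight G w p \<in> positive_reals) \<and>
    (\<forall>p. ug_cycle G p \<and> odd (vwalk_length p) \<longrightarrow> walk_weight G w p \<in> negative_reals)"
    (is "?rank \<longleftrightarrow> ug_tree G \<or> ?cycles")
proof -

  \<comment> \<open>From cycles to closed walks of gain 1\<close>
  interpret vec_space "TYPE(complex)" n .
  interpret G: pair_digraph G using assms(3) by (simp add: oriented_graph_def)
  let ?H = "underlying G"
  let ?A = "signless_incidence n m e w"
  let ?C = "set (cols ?A)"
  define f where "f i j = - sgn (adj_entry G w i j)" for i j
  \<comment> \<open>Row \<open>u - 1\<close> belongs to vertex \<open>u\<close>; \<open>b 0\<close>
    is a junk value, as \<open>0\<close> is no vertex.\<close>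
  define b where "b u = (unit_vec n (u - 1) :: complex vec)" for u
  have b_carrier [simp]: "b u \<in> carrier_vec n" for u by (simp add: b_def)
  have b_dim [simp]: "dim_vec (b u) = n" for u by (simp add: b_def)
  have nsym: "(v, u) \<notin> parcs G" if "(u, v) \<in> parcs G" for u v
    using assms(3) that by (auto simp: oriented_graph_def)
  have verts: "verts ?H = {1..n}" using assms(5) by (simp add: underlying_def)
  have arcs_verts: "u \<in> {1..n} \<and> v \<in> {1..n} \<and> u \<noteq> v" if "(u, v) \<in> parcs G" for u v
    using that G.wellformed[of "(u, v)"] G.no_loops'[of u v] assms(5) by auto
  \<comment> \<open>For the reversed arc, \<open>nsym\<close> excludes the first branch of
    \<open>adj_entry\<close>.\<close>
  have f_arc: "f u v = - sgn (w u v)" "f v u = - cnj (sgn (w u v))" if "(u, v) \<in> parcs G" for u v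
    using that nsym[OF that] by (auto simp: f_def adj_entry_def sgn_eq)
  have sgn_cnj: "sgn z * cnj (sgn z) = 1" if "z \<noteq> 0" for z :: complex
    using that by (simp add: complex_norm_square[symmetric] norm_sgn)
  have f_inv: "f u v * f v u = 1" if "(u, v) \<in> arcs_ends ?H" for u v
    using that f_arc assms(7) sgn_cnj by (auto simp: arcs_ends_underlying mult.commute)
  have noloop: "(u, u) \<notin> arcs_ends ?H" for u
    using arcs_verts by (auto simp: arcs_ends_underlying)
  have conn: "\<exists>p. vwalk p ?H \<and> hd p = u \<and> last p = v" if "u \<in> verts ?H" "v \<in> verts ?H" for u v
  proof -
    interpret S: pair_digraph "mk_symmetric (with_proj G)" by (rule G.digraph_mk_symmetric)
    show ?thesis
      using assms(4) that S.reachable_vwalk_conv[of u v]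
      unfolding weakly_connected_def connected_def strongly_connected_def underlying_def by auto
  qed
  have cycle_iff: "gain f p = 1 \<longleftrightarrow>
    (if even (vwalk_length p) then walk_weight G w p \<in> positive_reals
     else walk_weight G w p \<in> negative_reals)" for p
    unfolding f_def by (rule gain_neg_sgn_eq_1_iff)
  have "ug_tree G \<or> ?cycles \<longleftrightarrow> (\<forall>p. ug_cycle G p \<longrightarrow> gain f p = 1)"
    unfolding cycle_iff ug_tree_def by auto
  also have "\<dots> \<longleftrightarrow> (\<forall>p. vwalk p ?H \<and> hd p = last p \<longrightarrow> gain f p = 1)"
    using closed_walk_gain_one[of ?H f] noloop f_inv unfolding ug_cycle_def by blast
  finally have rhs: "ug_tree G \<or> ?cycles \<longleftrightarrow> (\<forall>p. vwalk p ?H \<and> hd p = last p \<longrightarrow> gain f p = 1)" .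

  \<comment> \<open>Columns of the matrix and their span\<close>
  have A: "?A \<in> carrier_mat n m" by (simp add: signless_incidence_def)
  have C: "?C \<subseteq> carrier_vec n" using cols_dim[of ?A] A by auto
  define c where "c u v = csqrt (w u v) \<cdot>\<^sub>v b u + cnj (csqrt (w u v)) \<cdot>\<^sub>v b v" for u v
  have col: "col ?A j = (case e (j + 1) of (u, v) \<Rightarrow> c u v)" if "j < m" for j
  proof -
    obtain u v where uv: "e (j + 1) = (u, v)" by fastforce
    have "e (j + 1) \<in> parcs G" using that by (intro bij_betwE[OF assms(6), rule_format]) auto
    then have arc: "(u, v) \<in> parcs G" using uv by simp
    \<comment> \<open>The weights avoid the branch cut, so the entry at the head of the edge is the
      conjugate of the entry at its tail.\<close>
    have s: "csqrt (cnj (w u v)) = cnj (csqrt (w u v))" using csqrt_cnj assms(7)[OF arc] by blast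
    \<comment> \<open>Vertices start at 1, so writing them as successors removes the truncated
      subtraction in \<open>b\<close>.\<close>
    obtain i k where ik: "u = Suc i" "v = Suc k"
      using arcs_verts[OF arc] by (metis One_nat_def Suc_le_D atLeastAtMost_iff)
    have "e (Suc j) = (Suc i, Suc k)" using uv ik by simp
    then show ?thesis
      using arcs_verts[OF arc] that s unfolding uv ik c_def b_def signless_incidence_def
      by (intro eq_vecI) (auto simp: incidence_entry_def simp del: csqrt.simps)
  qed
  have C_eq: "?C = (\<lambda>(u, v). c u v) ` parcs G"
  proof -
    have "?C = (\<lambda>j. col ?A j) ` {0..<m}" using A by (auto simp: cols_def)
    also have "\<dots> = (\<lambda>j. case e (j + 1) of (u, v) \<Rightarrow> c u v) ` {0..<m}"
      using col by (intro image_cong) auto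
    also have "\<dots> = (\<lambda>(u, v). c u v) ` e ` Suc ` {0..<m}" by (simp add: image_image del: image_Suc_atLeastLessThan)
    also have "Suc ` {0..<m} = {1..m}" by (simp add: atLeastLessThanSuc_atLeastAtMost)
    also have "e ` {1..m} = parcs G" using assms(6) by (simp add: bij_betw_def)
    finally show ?thesis .
  qed
  have c_span: "c u v \<in> span ?C" if "(u, v) \<in> parcs G" for u v
    using in_own_span[OF C] C_eq that by auto
  \<comment> \<open>The column of the edge is divided by its coefficient at \<open>v\<close>. By
    \<open>csqrt_quotient\<close> the coefficient at \<open>u\<close> becomes
    \<open>sgn (w u v)\<close>, or the conjugate of \<open>sgn (w v u)\<close> if the edge runs from
    \<open>v\<close> to \<open>u\<close>.\<close>
  have step: "b v + (- f u v) \<cdot>\<^sub>v b u \<in> span ?C" if arc: "(u, v) \<in> arcs_ends ?H" for u v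
  proof -
    consider "(u, v) \<in> parcs G" | "(v, u) \<in> parcs G" using arc by (auto simp: arcs_ends_underlying)
    then show ?thesis
    proof cases
      case 1
      let ?s = "csqrt (w u v)"
      have "?s \<noteq> 0" using assms(7)[OF 1] by (simp del: csqrt.simps)
      then have "b v + (- f u v) \<cdot>\<^sub>v b u = (1 / cnj ?s) \<cdot>\<^sub>v c u v"
        unfolding f_arc[OF 1] c_def csqrt_quotient[symmetric]
        by (intro eq_vecI) (auto simp: field_simps simp del: csqrt.simps)
      then show ?thesis using smult_in_span[OF C c_span[OF 1]] by simp
    next
      case 2
      let ?s = "csqrt (w v u)"
      have "?s \<noteq> 0" using assms(7)[OF 2] by (simp del: csqrt.simps)
      then have "b v + (- f u v) \<cdot>\<^sub>v b u = (1 / ?s) \<cdot>\<^sub>v c v u"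
        unfolding f_arc[OF 2] c_def csqrt_quotient[symmetric]
        by (intro eq_vecI) (auto simp: field_simps simp del: csqrt.simps)
      then show ?thesis using smult_in_span[OF C c_span[OF 2]] by simp
    qed
  qed
  \<comment> \<open>Walks carry one vertex vector \<open>b h\<close> to all others. Below,
    \<open>U\<close> is either the set of columns with \<open>b 1\<close> added or the columns
    alone.\<close>
  have generate: "carrier_vec n \<subseteq> span U"
    if U: "U \<subseteq> carrier_vec n" "?C \<subseteq> U" and h: "h \<in> verts ?H" "b h \<in> span U" for U h
  proof -
    have "b v \<in> span U" if v: "v \<in> verts ?H" for v
    proof -
      obtain p where p: "vwalk p ?H" "hd p = h" "last p = v" using conn[OF h(1) v] by blast
      have "b v' + (- f u v') \<cdot>\<^sub>v b u \<in> span U" if "(u, v') \<in> arcs_ends ?H" for u v'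
        using step[OF that] span_is_monotone[OF U(2)] by blast
      then have "b v + (- gain f p) \<cdot>\<^sub>v b h \<in> span U"
        using walk_combination_in_span[where b = b and f = f and H = ?H, OF U(1) b_carrier _ p(1)] p
        by simp
      then have "(b v + (- gain f p) \<cdot>\<^sub>v b h) + gain f p \<cdot>\<^sub>v b h \<in> span U"
        using span_add1[OF _ _ smult_in_span[OF U(1) h(2)], of _ "gain f p"] U(1) by simp
      also have "(b v + (- gain f p) \<cdot>\<^sub>v b h) + gain f p \<cdot>\<^sub>v b h = b v"
        by (intro eq_vecI) auto
      finally show ?thesis .
    qed
    moreover have "set (unit_vecs n) = b ` {1..n}"
    proof -
      have "set (unit_vecs n) = unit_vec n ` {0..<n}" by (auto simp: unit_vecs_def)
      also have "{0..<n} = (\<lambda>u. u - 1) ` {1..n}" by (force simp: image_iff intro: bexI[of _ "Suc _"])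
      finally show ?thesis by (simp add: b_def image_image)
    qed
    ultimately have "set (unit_vecs n) \<subseteq> span U" using verts by auto
    from span_subsetI[OF U(1) this] show ?thesis unfolding span_unit_vecs_is_carrier .
  qed

  \<comment> \<open>Rank \<open>n - 1\<close> versus full rank\<close>
  have one: "1 \<in> verts ?H" using assms(1) verts by simp
  have "b 1 \<in> span (insert (b 1) ?C)" using in_own_span[of "insert (b 1) ?C"] C by auto
  then have "n \<le> Suc (rank ?A)"
    using generate[of "insert (b 1) ?C" 1] one C by (intro dim_le_Suc_rank[OF A, of "b 1"]) auto
  \<comment> \<open>The rank is \<open>n - 1\<close> or \<open>n\<close>, and these differ since
    \<open>n\<close> is not 0.\<close>
  then have "?rank \<longleftrightarrow> rank ?A \<noteq> n"
    using rank_le_dim[OF A] assms(1) by auto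
  also have "\<dots> \<longleftrightarrow> span ?C \<noteq> carrier_vec n" using rank_eq_dim_iff[OF A] by simp
  also have "\<dots> \<longleftrightarrow> (\<forall>p. vwalk p ?H \<and> hd p = last p \<longrightarrow> gain f p = 1)"
  proof
    assume nonfull: "span ?C \<noteq> carrier_vec n"
    show "\<forall>p. vwalk p ?H \<and> hd p = last p \<longrightarrow> gain f p = 1"
    proof (intro allI impI, rule ccontr)
      fix p assume p: "vwalk p ?H \<and> hd p = last p" and ne: "gain f p \<noteq> 1"
      \<comment> \<open>For a closed walk the relation reads \<open>?k\<close> times
        \<open>b ?h\<close>, and \<open>?k\<close> is nonzero.\<close>
      let ?h = "hd p" and ?k = "1 - gain f p"
      have h: "?h \<in> verts ?H" using p by (auto simp: vwalk_def)
      have "b (last p) + (- gain f p) \<cdot>\<^sub>v b ?h \<in> span ?C"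
        by (rule walk_combination_in_span[where b = b and f = f and H = ?H, OF C b_carrier step])
          (use p in auto)
      then have "(1 / ?k) \<cdot>\<^sub>v (b ?h + (- gain f p) \<cdot>\<^sub>v b ?h) \<in> span ?C"
        using smult_in_span[OF C, of _ "1 / ?k"] p by simp
      also have "(1 / ?k) \<cdot>\<^sub>v (b ?h + (- gain f p) \<cdot>\<^sub>v b ?h) = b ?h"
        using ne by (intro eq_vecI) (auto simp: field_simps)
      finally have "carrier_vec n \<subseteq> span ?C" by (rule generate[OF C subset_refl h])
      then show False using nonfull span_closed[OF C] by auto
    qed
  next
    assume closed: "\<forall>p. vwalk p ?H \<and> hd p = last p \<longrightarrow> gain f p = 1"
    obtain x where x1: "x 1 = 1"
      and x: "\<And>u v. u \<in> verts ?H \<Longrightarrow> v \<in> verts ?H \<Longrightarrow> (u, v) \<in> arcs_ends ?H \<Longrightarrow> x v = x u * f u v"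
      by (rule potential_exists[where H = ?H and f = f and r = 1]) (use conn closed one in auto)
    \<comment> \<open>The potential as a row vector, nonzero because its entry for vertex 1 is
      1.\<close>
    let ?x = "vec n (\<lambda>i. x (i + 1))"
    have xb: "?x \<bullet> b u = x u" if "u \<in> {1..n}" for u
      using that by (auto simp: b_def)
    show "span ?C \<noteq> carrier_vec n"
    proof (rule span_neq_carrier[OF C])
      show "?x \<in> carrier_vec n" by simp
      have "?x $ 0 = 1" "0\<^sub>v n $ 0 = (0 :: complex)" using x1 assms(1) by auto
      then show "?x \<noteq> 0\<^sub>v n" by (metis zero_neq_one)
      fix y assume "y \<in> ?C"
      then obtain u v where uv: "(u, v) \<in> parcs G" and y: "y = c u v" using C_eq by auto
      let ?s = "csqrt (w u v)"
      have ne: "?s \<noteq> 0" using assms(7)[OF uv] by (simp del: csqrt.simps)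
      have V: "u \<in> {1..n}" "v \<in> {1..n}" using arcs_verts[OF uv] by auto
      have "?x \<bullet> y = ?s * x u + cnj ?s * x v"
        unfolding y c_def using xb V
        by (simp add: scalar_prod_add_distrib[of _ n] del: csqrt.simps)
      \<comment> \<open>\<open>f u v\<close> is \<open>- sgn (w u v)\<close>, rewritten as a
        quotient of roots so that the two terms cancel.\<close>
      also have "x v = x u * - (?s / cnj ?s)"
        using x[of u v] V uv verts f_arc[OF uv] csqrt_quotient by (simp add: arcs_ends_underlying del: csqrt.simps)
      also have "?s * x u + cnj ?s * (x u * - (?s / cnj ?s)) = 0"
        using ne by (simp add: field_simps del: csqrt.simps)
      finally show "?x \<bullet> y = 0" .
    qed
  qed
  finally show ?thesis using rhs by simp
qed

end
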